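(* The logic $\mathsf L(\{\mathfrak R_2,\mathfrak F_2\})=\mathsf L(\mathfrak R_2)\cap\mathsf L(\mathfrak F_2)$ has nullary unification.
   Context: A frame is a finite poset with a least element; for a class $\mathbf F$ of frames $\mathsf L(\mathbf F)$ is the set of intuitionistic formulas valid in every Kripke model over every frame of $\mathbf F$. $\mathfrak F_2$ is the three-element fork (a root with two incomparable maximal elements above it); $\mathfrak R_2$ is the rhombus ($\mathfrak F_2$ with a top element added above everything). Unification in a logic $\mathsf L$ is nullary if some $\mathsf L$-unifiable formula has no minimal (w.r.t. inclusion) complete set of unifiers, where a set $\Sigma$ of unifiers of $A$ is complete if every unifier $\mu$ of $A$ satisfies $\alpha\circ\varepsilon=_{\mathsf L}\mu$ for some $\varepsilon\in\Sigma$ and substitution $\alpha$. *)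

theory Defs
  imports "HOL-Library.FuncSet"
begin

section \<open>Intuitionistic formulas and substitutions\<close>

datatype form =
    Var nat
  | Bot
  | And form form
  | Or form form
  | Imp form form

definition Iff :: "form \<Rightarrow> form \<Rightarrow> form" where
  "Iff A B = And (Imp A B) (Imp B A)"

primrec vars :: "form \<Rightarrow> nat set" where
  "vars (Var i) = {i}"
| "vars Bot = {}"
| "vars (And A B) = vars A \<union> vars B"
| "vars (Or A B) = vars A \<union> vars B"
| "vars (Imp A B) = vars A \<union> vars B"

definition Fm :: "nat \<Rightarrow> form set" where
  "Fm n = {A. vars A \<subseteq> {..<n}}"

primrec subst :: "(nat \<Rightarrow> form) \<Rightarrow> form \<Rightarrow> form" where
  "subst \<sigma> (Var i) = \<sigma> i"
| "subst \<sigma> Bot = Bot"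
| "subst \<sigma> (And A B) = And (subst \<sigma> A) (subst \<sigma> B)"
| "subst \<sigma> (Or A B) = Or (subst \<sigma> A) (subst \<sigma> B)"
| "subst \<sigma> (Imp A B) = Imp (subst \<sigma> A) (subst \<sigma> B)"

text \<open>A substitution is a finite mapping from the first \<open>n\<close> variables to formulas in the first
  \<open>k\<close> variables. It has no values outside \<open>{..<n}\<close>, so two substitutions with domain \<open>n\<close> are
  compared on the variables below \<open>n\<close> only.\<close>

definition substitutions :: "nat \<Rightarrow> nat \<Rightarrow> (nat \<Rightarrow> form) set" where
  "substitutions n k = {..<n} \<rightarrow>\<^sub>E Fm k"

definition subst_comp :: "nat \<Rightarrow> (nat \<Rightarrow> form) \<Rightarrow> (nat \<Rightarrow> form) \<Rightarrow> nat \<Rightarrow> form" where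
  "subst_comp n \<alpha> \<epsilon> = (\<lambda>i\<in>{..<n}. subst \<alpha> (\<epsilon> i))"

lemma subst_subst_comp:
  "A \<in> Fm n \<Longrightarrow> subst (subst_comp n \<alpha> \<epsilon>) A = subst \<alpha> (subst \<epsilon> A)"
  by (induction A) (auto simp: Fm_def subst_comp_def)

lemma subst_in_Fm:
  "\<lbrakk>\<epsilon> \<in> substitutions n k; A \<in> Fm n\<rbrakk> \<Longrightarrow> subst \<epsilon> A \<in> Fm k"
proof (induction A)
  case (Var i)
  then show ?case by (auto simp: substitutions_def Fm_def PiE_iff)
qed (auto simp: Fm_def)

lemma subst_comp_in_substitutions:
  "\<lbrakk>\<epsilon> \<in> substitutions n k; \<alpha> \<in> substitutions k m\<rbrakk> \<Longrightarrow> subst_comp n \<alpha> \<epsilon> \<in> substitutions n m"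
  by (auto simp: substitutions_def[of n] subst_comp_def PiE_iff intro: subst_in_Fm)


section \<open>Kripke models and the logic of a class of frames\<close>

record 'w frame =
  worlds :: "'w set"
  order :: "('w \<times> 'w) set"

definition is_frame :: "'w frame \<Rightarrow> bool" where
  "is_frame F \<longleftrightarrow> finite (worlds F) \<and> partial_order_on (worlds F) (order F) \<and>
     (\<exists>r\<in>worlds F. \<forall>w\<in>worlds F. (r, w) \<in> order F)"

definition valuation :: "'w frame \<Rightarrow> (nat \<Rightarrow> 'w set) \<Rightarrow> bool" where
  "valuation F V \<longleftrightarrow>
     (\<forall>i. V i \<subseteq> worlds F \<and> (\<forall>u v. u \<in> V i \<longrightarrow> (u, v) \<in> order F \<longrightarrow> v \<in> V i))"

primrec forces :: "'w frame \<Rightarrow> (nat \<Rightarrow> 'w set) \<Rightarrow> 'w \<Rightarrow> form \<Rightarrow> bool" where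
  "forces F V w (Var i) \<longleftrightarrow> w \<in> V i"
| "forces F V w Bot \<longleftrightarrow> False"
| "forces F V w (And A B) \<longleftrightarrow> forces F V w A \<and> forces F V w B"
| "forces F V w (Or A B) \<longleftrightarrow> forces F V w A \<or> forces F V w B"
| "forces F V w (Imp A B) \<longleftrightarrow>
     (\<forall>v\<in>worlds F. (w, v) \<in> order F \<longrightarrow> forces F V v A \<longrightarrow> forces F V v B)"

text \<open>Intended for classes of structures satisfying \<^const>\<open>is_frame\<close>.\<close>

definition logic_of :: "'w frame set \<Rightarrow> form set" where
  "logic_of \<F> =
     {A. \<forall>F\<in>\<F>. \<forall>V. valuation F V \<longrightarrow> (\<forall>w\<in>worlds F. forces F V w A)}"


section \<open>Fork and rhombus\<close>

definition fork :: "nat frame" where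
  "fork = \<lparr>worlds = {0, 1, 2}, order = {(0,0), (1,1), (2,2), (0,1), (0,2)}\<rparr>"

definition rhombus :: "nat frame" where
  "rhombus = \<lparr>worlds = insert 3 (worlds fork),
              order = order fork \<union> (insert 3 (worlds fork) \<times> {3})\<rparr>"

lemma is_frame_fork: "is_frame fork"
  unfolding is_frame_def fork_def partial_order_on_def preorder_on_def refl_on_def trans_def
    antisym_def
  by auto

lemma is_frame_rhombus: "is_frame rhombus"
  unfolding is_frame_def rhombus_def fork_def partial_order_on_def preorder_on_def refl_on_def
    trans_def antisym_def
  by auto


section \<open>Unification in a logic\<close>

definition equiv_in :: "form set \<Rightarrow> form \<Rightarrow> form \<Rightarrow> bool" where
  "equiv_in L A B \<longleftrightarrow> Iff A B \<in> L"

definition subst_equiv_in :: "form set \<Rightarrow> nat \<Rightarrow> (nat \<Rightarrow> form) \<Rightarrow> (nat \<Rightarrow> form) \<Rightarrow> bool" where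
  "subst_equiv_in L n \<sigma> \<tau> \<longleftrightarrow> (\<forall>A\<in>Fm n. equiv_in L (subst \<sigma> A) (subst \<tau> A))"

text \<open>Throughout, \<open>A\<close> is regarded as a formula of \<^term>\<open>Fm n\<close>, and its unifiers have domain \<open>n\<close>.\<close>

definition unifiers :: "form set \<Rightarrow> nat \<Rightarrow> form \<Rightarrow> (nat \<Rightarrow> form) set" where
  "unifiers L n A = {\<epsilon>. (\<exists>k. \<epsilon> \<in> substitutions n k) \<and> subst \<epsilon> A \<in> L}"

definition complete_unifiers :: "form set \<Rightarrow> nat \<Rightarrow> form \<Rightarrow> (nat \<Rightarrow> form) set \<Rightarrow> bool" where
  "complete_unifiers L n A \<Sigma> \<longleftrightarrow> \<Sigma> \<subseteq> unifiers L n A \<and>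
     (\<forall>\<mu>\<in>unifiers L n A. \<exists>\<epsilon>\<in>\<Sigma>. \<exists>k m \<alpha>.
        \<epsilon> \<in> substitutions n k \<and> \<alpha> \<in> substitutions k m \<and>
        subst_equiv_in L n (subst_comp n \<alpha> \<epsilon>) \<mu>)"

definition minimal_complete_unifiers ::
    "form set \<Rightarrow> nat \<Rightarrow> form \<Rightarrow> (nat \<Rightarrow> form) set \<Rightarrow> bool" where
  "minimal_complete_unifiers L n A \<Sigma> \<longleftrightarrow> complete_unifiers L n A \<Sigma> \<and>
     (\<forall>\<Sigma>'. \<Sigma>' \<subset> \<Sigma> \<longrightarrow> \<not> complete_unifiers L n A \<Sigma>')"

definition nullary_unification :: "form set \<Rightarrow> bool" where
  "nullary_unification L \<longleftrightarrow>
     (\<exists>n. \<exists>A\<in>Fm n. unifiers L n A \<noteq> {} \<and> \<not> (\<exists>\<Sigma>. minimal_complete_unifiers L n A \<Sigma>))"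

end

theory Submission
  imports Defs
begin

text \<open>
  The formula \<open>(p \<or> q) \<and> \<not>\<not>p \<and> \<not>\<not>q\<close> has no maximal unifier. A unifier is a pair \<open>(B, C)\<close> of
  classical tautologies such that \<open>B \<or> C\<close> is valid. Below the single maximal point of a rhombus
  the formulas \<open>B\<close> and \<open>C\<close> cannot fail at two different successors of a common root, but a fork over
  two distinct maximal points may refute one formula while the chains over them refute the other. For
  a unifier in \<open>k\<close> variables, add, marked by a new variable \<open>r\<close>, more than \<open>2\<^sup>k\<close>
  maximal points such that the chains below them refute \<open>C'\<close> and the forks below any two of them
  refute \<open>B'\<close>. Setting \<open>r\<close> to \<open>\<bottom>\<close> recovers \<open>(B, C)\<close>. If \<open>(B', C')\<close> were an instance of \<open>(B, C)\<close>,
  these points would be mapped injectively to the \<open>2\<^sup>k\<close> classical valuations of the \<open>k\<close> variables.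
\<close>

section \<open>Persistence, locality and substitution for Kripke forcing\<close>

lemma frame_refl: "is_frame F \<Longrightarrow> w \<in> worlds F \<Longrightarrow> (w, w) \<in> order F"
  by (auto simp: is_frame_def partial_order_on_def preorder_on_def refl_on_def)

lemma frame_trans:
  "is_frame F \<Longrightarrow> (u, v) \<in> order F \<Longrightarrow> (v, w) \<in> order F \<Longrightarrow> (u, w) \<in> order F"
  by (meson is_frame_def partial_order_on_def preorder_on_def transD)

lemma forces_mp:
  "is_frame F \<Longrightarrow> w \<in> worlds F \<Longrightarrow> forces F V w (Imp A B) \<Longrightarrow> forces F V w A \<Longrightarrow> forces F V w B"
  using frame_refl by fastforce

lemma forces_mono:
  assumes "is_frame F" "valuation F V" "(u, v) \<in> order F" "v \<in> worlds F" "forces F V u A"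
  shows "forces F V v A"
  using assms(3-5)
proof (induction A)
  case (Var i)
  then show ?case using assms(2) by (auto simp: valuation_def)
next
  case (Imp A B)
  then show ?case using frame_trans[OF assms(1)] by auto
qed auto

lemma forces_cong:
  assumes "\<And>i. i \<in> vars A \<Longrightarrow> V i \<inter> worlds F = W i \<inter> worlds F" "w \<in> worlds F"
  shows "forces F V w A \<longleftrightarrow> forces F W w A"
  using assms by (induction A arbitrary: w) auto

definition subst_val :: "'w frame \<Rightarrow> (nat \<Rightarrow> 'w set) \<Rightarrow> (nat \<Rightarrow> form) \<Rightarrow> nat \<Rightarrow> 'w set" where
  "subst_val F V s = (\<lambda>i. {w \<in> worlds F. forces F V w (s i)})"

lemma mem_subst_val: "w \<in> subst_val F V s i \<longleftrightarrow> w \<in> worlds F \<and> forces F V w (s i)"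
  by (simp add: subst_val_def)

lemma forces_subst:
  "w \<in> worlds F \<Longrightarrow> forces F V w (subst s A) \<longleftrightarrow> forces F (subst_val F V s) w A"
  by (induction A arbitrary: w) (auto simp: subst_val_def)

lemma valuation_subst_val:
  assumes "is_frame F" "valuation F V"
  shows "valuation F (subst_val F V s)"
proof -
  have "order F \<subseteq> worlds F \<times> worlds F"
    using assms(1) by (auto simp: is_frame_def partial_order_on_def preorder_on_def refl_on_def)
  then show ?thesis
    using forces_mono[OF assms] by (force simp: valuation_def subst_val_def)
qed

lemma subst_cong: "(\<And>i. i \<in> vars A \<Longrightarrow> s i = t i) \<Longrightarrow> subst s A = subst t A"
  by (induction A) auto

lemma subst_Var: "(\<And>i. i \<in> vars A \<Longrightarrow> s i = Var i) \<Longrightarrow> subst s A = A"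
  by (induction A) auto

lemma subst_subst: "subst s (subst t A) = subst (\<lambda>i. subst s (t i)) A"
  by (induction A) auto

lemma finite_vars: "finite (vars A)"
  by (induction A) auto

lemma ex_bound_Fm: fixes k :: nat shows "\<exists>m. \<forall>i<k. s i \<in> Fm m"
proof -
  have "finite (\<Union>i<k. vars (s i))" by (auto simp: finite_vars)
  then obtain m where "(\<Union>i<k. vars (s i)) \<subseteq> {..<m}"
    unfolding finite_nat_set_iff_bounded by blast
  then show ?thesis by (auto simp: Fm_def)
qed


section \<open>The instance preorder on substitutions\<close>

text \<open>Total substitutions avoid the bookkeeping of domains and codomains, which need not match
  when two instantiations in the sense of \<^const>\<open>complete_unifiers\<close> are composed.\<close>

definition instance_in :: "form set \<Rightarrow> nat \<Rightarrow> (nat \<Rightarrow> form) \<Rightarrow> (nat \<Rightarrow> form) \<Rightarrow> bool" where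
  "instance_in L n \<mu> \<epsilon> \<longleftrightarrow> (\<exists>s. \<forall>i<n. equiv_in L (subst s (\<epsilon> i)) (\<mu> i))"

context
  fixes \<F> :: "'w frame set"
  assumes frames: "\<forall>F\<in>\<F>. is_frame F"
begin

lemma equiv_in_logic_of:
  "equiv_in (logic_of \<F>) A B \<longleftrightarrow>
    (\<forall>F\<in>\<F>. \<forall>V. valuation F V \<longrightarrow> (\<forall>w\<in>worlds F. forces F V w A \<longleftrightarrow> forces F V w B))"
  using frame_refl[OF frames[rule_format]] by (fastforce simp: equiv_in_def Iff_def logic_of_def)

lemma equiv_in_trans:
  "equiv_in (logic_of \<F>) A B \<Longrightarrow> equiv_in (logic_of \<F>) B C \<Longrightarrow> equiv_in (logic_of \<F>) A C"
  by (auto simp: equiv_in_logic_of)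

lemma equiv_in_subst:
  "equiv_in (logic_of \<F>) A B \<Longrightarrow> equiv_in (logic_of \<F>) (subst s A) (subst s B)"
  by (simp add: equiv_in_logic_of forces_subst valuation_subst_val[OF frames[rule_format]])

text \<open>Forcing \<open>subst \<sigma> A\<close> amounts to forcing \<open>A\<close> under
  \<open>subst_val F V \<sigma>\<close>, so agreement on the variables propagates to all of
  \<open>Fm n\<close>.\<close>

lemma subst_equiv_in_iff:
  "subst_equiv_in (logic_of \<F>) n \<sigma> \<tau> \<longleftrightarrow> (\<forall>i<n. equiv_in (logic_of \<F>) (\<sigma> i) (\<tau> i))"
proof
  assume *: "subst_equiv_in (logic_of \<F>) n \<sigma> \<tau>"
  show "\<forall>i<n. equiv_in (logic_of \<F>) (\<sigma> i) (\<tau> i)"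
  proof (intro allI impI)
    fix i assume "i < n"
    then have "Var i \<in> Fm n" by (simp add: Fm_def)
    with * show "equiv_in (logic_of \<F>) (\<sigma> i) (\<tau> i)"
      unfolding subst_equiv_in_def by (metis subst.simps(1))
  qed
next
  assume *: "\<forall>i<n. equiv_in (logic_of \<F>) (\<sigma> i) (\<tau> i)"
  show "subst_equiv_in (logic_of \<F>) n \<sigma> \<tau>"
    unfolding subst_equiv_in_def equiv_in_logic_of
  proof (intro ballI allI impI)
    fix A F V w assume "A \<in> Fm n" "F \<in> \<F>" "valuation F V" "w \<in> worlds F"
    then show "forces F V w (subst \<sigma> A) \<longleftrightarrow> forces F V w (subst \<tau> A)"
      using * unfolding forces_subst[OF \<open>w \<in> worlds F\<close>]
      by (intro forces_cong) (auto simp: Fm_def equiv_in_logic_of subst_val_def subset_iff)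
  qed
qed

lemma instance_in_trans:
  assumes "instance_in (logic_of \<F>) n \<mu> \<epsilon>" "instance_in (logic_of \<F>) n \<epsilon> \<delta>"
  shows "instance_in (logic_of \<F>) n \<mu> \<delta>"
proof -
  obtain s t where "\<forall>i<n. equiv_in (logic_of \<F>) (subst s (\<epsilon> i)) (\<mu> i)"
    and "\<forall>i<n. equiv_in (logic_of \<F>) (subst t (\<delta> i)) (\<epsilon> i)"
    using assms by (auto simp: instance_in_def)
  then have "\<forall>i<n. equiv_in (logic_of \<F>) (subst s (subst t (\<delta> i))) (\<mu> i)"
    using equiv_in_subst equiv_in_trans by blast
  then show ?thesis by (auto simp: instance_in_def subst_subst)
qed

text \<open>Only the values of \<open>s\<close> below \<open>j\<close> matter, because
  \<open>\<epsilon>\<close> uses no other variables; being finitely many, they lie in a common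
  \<open>Fm m\<close>.\<close>

lemma instance_in_iff:
  assumes "\<epsilon> \<in> substitutions n j"
  shows "instance_in (logic_of \<F>) n \<mu> \<epsilon> \<longleftrightarrow>
    (\<exists>k m \<alpha>. \<epsilon> \<in> substitutions n k \<and> \<alpha> \<in> substitutions k m \<and>
      subst_equiv_in (logic_of \<F>) n (subst_comp n \<alpha> \<epsilon>) \<mu>)" (is "_ \<longleftrightarrow> ?R")
proof
  assume "instance_in (logic_of \<F>) n \<mu> \<epsilon>"
  then obtain s where s: "\<forall>i<n. equiv_in (logic_of \<F>) (subst s (\<epsilon> i)) (\<mu> i)"
    by (auto simp: instance_in_def)
  obtain m where m: "\<forall>i<j. s i \<in> Fm m" using ex_bound_Fm by blast
  have "restrict s {..<j} \<in> substitutions j m" using m by (auto simp: substitutions_def)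
  moreover have "subst (restrict s {..<j}) (\<epsilon> i) = subst s (\<epsilon> i)" if "i < n" for i
    using assms that by (intro subst_cong) (auto simp: substitutions_def Fm_def PiE_iff)
  ultimately show ?R
    using assms s
    by (intro exI[of _ j] exI[of _ m] exI[of _ "restrict s {..<j}"])
       (auto simp: subst_equiv_in_iff subst_comp_def)
next
  assume ?R
  then show "instance_in (logic_of \<F>) n \<mu> \<epsilon>"
    by (auto simp: subst_equiv_in_iff subst_comp_def instance_in_def)
qed

lemma complete_unifiers_iff:
  "complete_unifiers (logic_of \<F>) n A \<Sigma> \<longleftrightarrow> \<Sigma> \<subseteq> unifiers (logic_of \<F>) n A \<and>
     (\<forall>\<mu>\<in>unifiers (logic_of \<F>) n A. \<exists>\<epsilon>\<in>\<Sigma>. instance_in (logic_of \<F>) n \<mu> \<epsilon>)"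
proof (cases "\<Sigma> \<subseteq> unifiers (logic_of \<F>) n A")
  case True
  then have "\<exists>j. \<epsilon> \<in> substitutions n j" if "\<epsilon> \<in> \<Sigma>" for \<epsilon>
    using that by (auto simp: unifiers_def)
  then have "instance_in (logic_of \<F>) n \<mu> \<epsilon> \<longleftrightarrow>
    (\<exists>k m \<alpha>. \<epsilon> \<in> substitutions n k \<and> \<alpha> \<in> substitutions k m \<and>
      subst_equiv_in (logic_of \<F>) n (subst_comp n \<alpha> \<epsilon>) \<mu>)" if "\<epsilon> \<in> \<Sigma>" for \<epsilon> \<mu>
    using that instance_in_iff by blast
  then show ?thesis unfolding complete_unifiers_def by (simp cong: bex_cong)
qed (simp add: complete_unifiers_def)

lemma nullary_if_no_maximal:
  assumes "A \<in> Fm n" "unifiers (logic_of \<F>) n A \<noteq> {}"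
    and step: "\<And>\<epsilon>. \<epsilon> \<in> unifiers (logic_of \<F>) n A \<Longrightarrow> \<exists>\<epsilon>'\<in>unifiers (logic_of \<F>) n A.
      instance_in (logic_of \<F>) n \<epsilon> \<epsilon>' \<and> \<not> instance_in (logic_of \<F>) n \<epsilon>' \<epsilon>"
  shows "nullary_unification (logic_of \<F>)"
proof -
  have False if min: "minimal_complete_unifiers (logic_of \<F>) n A \<Sigma>" for \<Sigma>
  proof -
    have com: "complete_unifiers (logic_of \<F>) n A \<Sigma>"
      using min by (simp add: minimal_complete_unifiers_def)
    obtain \<epsilon> where \<epsilon>: "\<epsilon> \<in> \<Sigma>" "\<epsilon> \<in> unifiers (logic_of \<F>) n A"
      using com assms(2) unfolding complete_unifiers_iff by blast
    obtain \<epsilon>' where \<epsilon>': "\<epsilon>' \<in> unifiers (logic_of \<F>) n A"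
      "instance_in (logic_of \<F>) n \<epsilon> \<epsilon>'" "\<not> instance_in (logic_of \<F>) n \<epsilon>' \<epsilon>"
      using step[OF \<epsilon>(2)] by blast
    obtain \<delta> where \<delta>: "\<delta> \<in> \<Sigma>" "instance_in (logic_of \<F>) n \<epsilon>' \<delta>"
      using com \<epsilon>'(1) by (auto simp: complete_unifiers_iff)
    have "\<delta> \<noteq> \<epsilon>" using \<delta>(2) \<epsilon>'(3) by auto
    moreover have "instance_in (logic_of \<F>) n \<epsilon> \<delta>"
      using instance_in_trans \<delta>(2) \<epsilon>'(2) by blast
    ultimately have "complete_unifiers (logic_of \<F>) n A (\<Sigma> - {\<epsilon>})"
      using com \<delta>(1) instance_in_trans unfolding complete_unifiers_iff by blast
    moreover have "\<Sigma> - {\<epsilon>} \<subset> \<Sigma>" using \<epsilon>(1) by blast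
    ultimately show False using min by (auto simp: minimal_complete_unifiers_def)
  qed
  then show ?thesis using assms(1,2) by (auto simp: nullary_unification_def)
qed

end


section \<open>Forcing on the fork and the rhombus\<close>

abbreviation Neg :: "form \<Rightarrow> form" where
  "Neg A \<equiv> Imp A Bot"

lemma worlds_fork [simp]: "worlds fork = {0, 1, 2}"
  by (simp add: fork_def)

lemma worlds_rhombus [simp]: "worlds rhombus = {0, 1, 2, 3}"
  by (auto simp: rhombus_def)

lemma order_fork: "(u, v) \<in> order fork \<longleftrightarrow> u = v \<and> u \<in> {0, 1, 2} \<or> u = 0 \<and> v \<in> {1, 2}"
  by (auto simp: fork_def)

lemma order_rhombus:
  "(u, v) \<in> order rhombus \<longleftrightarrow> u = v \<and> u \<in> {0, 1, 2, 3} \<or> u = 0 \<and> v \<in> {1, 2, 3} \<or> u \<in> {1, 2} \<and> v = 3"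
  by (auto simp: rhombus_def fork_def)

lemma forces_fork_Imp:
  "forces fork V 0 (Imp A B) \<longleftrightarrow> (\<forall>v\<in>{0, 1, 2}. forces fork V v A \<longrightarrow> forces fork V v B)"
  "forces fork V (Suc 0) (Imp A B) \<longleftrightarrow> (forces fork V (Suc 0) A \<longrightarrow> forces fork V (Suc 0) B)"
  "forces fork V 2 (Imp A B) \<longleftrightarrow> (forces fork V 2 A \<longrightarrow> forces fork V 2 B)"
  by (auto simp: order_fork)

lemma forces_rhombus_Imp:
  "forces rhombus V 0 (Imp A B) \<longleftrightarrow>
    (\<forall>v\<in>{0, 1, 2, 3}. forces rhombus V v A \<longrightarrow> forces rhombus V v B)"
  "forces rhombus V (Suc 0) (Imp A B) \<longleftrightarrow>
    (\<forall>v\<in>{1, 3}. forces rhombus V v A \<longrightarrow> forces rhombus V v B)"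
  "forces rhombus V 2 (Imp A B) \<longleftrightarrow>
    (\<forall>v\<in>{2, 3}. forces rhombus V v A \<longrightarrow> forces rhombus V v B)"
  "forces rhombus V 3 (Imp A B) \<longleftrightarrow> (forces rhombus V 3 A \<longrightarrow> forces rhombus V 3 B)"
  by (auto simp: order_rhombus)

lemma forces_fork_mono:
  assumes "valuation fork V" "forces fork V 0 A"
  shows "forces fork V (Suc 0) A" "forces fork V 2 A"
  using forces_mono[OF is_frame_fork assms(1) _ _ assms(2)] by (auto simp: order_fork)

lemma forces_rhombus_mono:
  assumes "valuation rhombus V"
  shows "forces rhombus V 0 A \<Longrightarrow> forces rhombus V (Suc 0) A"
    and "forces rhombus V 0 A \<Longrightarrow> forces rhombus V 2 A"
    and "forces rhombus V (Suc 0) A \<Longrightarrow> forces rhombus V 3 A"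
    and "forces rhombus V 2 A \<Longrightarrow> forces rhombus V 3 A"
  using forces_mono[OF is_frame_rhombus assms] by (auto simp: order_rhombus)

text \<open>A fork with equal leaves is bisimilar to each of the two-element chains inside a rhombus.\<close>

lemma forces_fork_rhombus:
  assumes "u \<in> {1, 2}"
    and eq: "\<And>i. i < k \<Longrightarrow> (3 \<in> W i \<longleftrightarrow> 1 \<in> V i) \<and> (3 \<in> W i \<longleftrightarrow> 2 \<in> V i) \<and> (u \<in> W i \<longleftrightarrow> 0 \<in> V i)"
    and "vars A \<subseteq> {..<k}"
  shows "(forces rhombus W 3 A \<longleftrightarrow> forces fork V 1 A) \<and> (forces rhombus W 3 A \<longleftrightarrow> forces fork V 2 A)
    \<and> (forces rhombus W u A \<longleftrightarrow> forces fork V 0 A)"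
  using assms(3)
proof (induction A)
  case (Var i)
  then show ?case using eq[of i] by auto
next
  case (And A B)
  then show ?case unfolding forces.simps(3) vars.simps(3) Un_subset_iff by blast
next
  case (Or A B)
  then show ?case unfolding forces.simps(4) vars.simps(4) Un_subset_iff by blast
next
  case (Imp A B)
  then have "vars A \<subseteq> {..<k}" "vars B \<subseteq> {..<k}" by auto
  with Imp.IH show ?case using assms(1)
    by (elim insertE) (simp_all add: forces_fork_Imp forces_rhombus_Imp del: forces.simps(5), blast+)
qed simp

text \<open>At the root of a fork, this conjunction of weak excluded middles says that the leaves agree on
  the first \<open>k\<close> variables.\<close>

primrec wem :: "nat \<Rightarrow> form" where
  "wem 0 = Neg Bot"
| "wem (Suc k) = And (wem k) (Or (Neg (Var k)) (Neg (Neg (Var k))))"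

lemma vars_wem: "vars (wem k) \<subseteq> {..<k}"
  by (induction k) auto

lemma forces_wem:
  "forces F V w (wem k) \<longleftrightarrow>
    (\<forall>i<k. forces F V w (Or (Neg (Var i)) (Neg (Neg (Var i)))))"
proof (induction k)
  case (Suc k)
  then show ?case unfolding wem.simps forces.simps(3) less_Suc_eq by blast
qed simp

text \<open>Every point sees the single top point, which decides each variable: if it refutes
  \<open>Var i\<close>, so does everything below it; otherwise no point forces
  \<open>Neg (Var i)\<close>.\<close>

lemma forces_rhombus_wem:
  assumes "valuation rhombus V" "w \<in> worlds rhombus"
  shows "forces rhombus V w (wem k)"
proof -
  have "0 \<in> V i \<longrightarrow> 3 \<in> V i" "Suc 0 \<in> V i \<longrightarrow> 3 \<in> V i" "2 \<in> V i \<longrightarrow> 3 \<in> V i" for i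
    using forces_rhombus_mono[OF assms(1), of "Var i"] by auto
  then have "forces rhombus V v (Neg (Var i)) \<or> forces rhombus V v (Neg (Neg (Var i)))"
    if "v \<in> {0, Suc 0, 2, 3}" for v i
    using that
    by (elim insertE) (auto simp: forces_rhombus_Imp simp del: forces.simps(5))
  then show ?thesis using assms(2) unfolding forces_wem by simp
qed

lemma forces_fork_wem_leaf:
  "forces fork V (Suc 0) (wem k)" "forces fork V 2 (wem k)"
  unfolding forces_wem forces.simps(4) forces_fork_Imp by simp_all

lemma forces_fork_wem_root:
  assumes "valuation fork V"
  shows "forces fork V 0 (wem k) \<longleftrightarrow> (\<forall>i<k. 1 \<in> V i \<longleftrightarrow> 2 \<in> V i)"
proof -
  have "0 \<in> V i \<Longrightarrow> 1 \<in> V i \<and> 2 \<in> V i" for i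
    using assms unfolding valuation_def order_fork by blast
  then show ?thesis unfolding forces_wem forces.simps(4) forces_fork_Imp
    by (simp add: forces_fork_Imp del: forces.simps(5)) blast
qed


section \<open>Unifiers without a maximal element\<close>

definition problem :: form where
  "problem = And (Or (Var 0) (Var 1)) (And (Neg (Neg (Var 0))) (Neg (Neg (Var 1))))"

abbreviation LRF :: "form set" where
  "LRF \<equiv> logic_of {rhombus, fork}"

lemma frames_RF: "\<forall>F\<in>{rhombus, fork}. is_frame F"
  using is_frame_fork is_frame_rhombus by auto

lemma in_LRF:
  "A \<in> LRF \<longleftrightarrow> (\<forall>V. valuation rhombus V \<longrightarrow> forces rhombus V 0 A) \<and>
    (\<forall>V. valuation fork V \<longrightarrow> forces fork V 0 A)"
proof -
  have "(\<forall>w\<in>worlds rhombus. forces rhombus V w A) \<longleftrightarrow> forces rhombus V 0 A"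
    if "valuation rhombus V" for V
    using forces_rhombus_mono[OF that, of A] by auto
  moreover have "(\<forall>w\<in>worlds fork. forces fork V w A) \<longleftrightarrow> forces fork V 0 A"
    if "valuation fork V" for V
    using forces_fork_mono[OF that, of A] by auto
  ultimately show ?thesis unfolding logic_of_def by blast
qed

text \<open>A double negation holds at a root iff the formula holds at all maximal points.\<close>

lemma subst_problem_in_LRF:
  "subst \<epsilon> problem \<in> LRF \<longleftrightarrow>
    (\<forall>V. valuation rhombus V \<longrightarrow> (forces rhombus V 0 (\<epsilon> 0) \<or> forces rhombus V 0 (\<epsilon> 1)) \<and>
      forces rhombus V 3 (\<epsilon> 0) \<and> forces rhombus V 3 (\<epsilon> 1)) \<and>
    (\<forall>V. valuation fork V \<longrightarrow> (forces fork V 0 (\<epsilon> 0) \<or> forces fork V 0 (\<epsilon> 1)) \<and>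
      (\<forall>v\<in>{1, 2}. forces fork V v (\<epsilon> 0) \<and> forces fork V v (\<epsilon> 1)))"
proof -
  have R: "forces rhombus V 0 (Neg (Neg A)) \<longleftrightarrow> forces rhombus V 3 A"
    if "valuation rhombus V" for V A
    using forces_rhombus_mono[OF that, of A]
    by (auto simp: forces_rhombus_Imp simp del: forces.simps(5))
  have F: "forces fork V 0 (Neg (Neg A)) \<longleftrightarrow> forces fork V 1 A \<and> forces fork V 2 A"
    if "valuation fork V" for V A
    using forces_fork_mono[OF that, of A]
    by (auto simp: forces_fork_Imp simp del: forces.simps(5))
  show ?thesis
    unfolding in_LRF problem_def subst.simps forces.simps(3,4) using R F by auto
qed

text \<open>Where all maximal points above refute \<open>r\<close> this amounts to \<open>B\<close>;
  where all satisfy \<open>r\<close>, to \<open>wem (Suc k)\<close>, which fails at a fork root iff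
  the leaves differ on one of \<open>Var 0\<close>, ..., \<open>Var k\<close>. Besides
  \<open>r\<close>, also \<open>Var k\<close> is new to formulas of \<open>Fm k\<close>: it raises
  the number of leaf types from \<open>2^k\<close> to \<open>2^(k+1)\<close>.\<close>

definition gen_p :: "nat \<Rightarrow> form \<Rightarrow> form" where
  "gen_p k B = (let r = Var (Suc k) in
     Or (And (Neg r) B) (And (Neg (Neg r)) (wem (Suc k))))"

text \<open>Where all maximal points above refute \<open>r\<close> this amounts to \<open>C\<close>.
  The second conjunct fails at the lower point of a chain on which \<open>r\<close> becomes true
  only at the top.\<close>

definition gen_q :: "nat \<Rightarrow> form \<Rightarrow> form" where
  "gen_q k C = (let r = Var (Suc k) in
     And (Imp (Neg r) C) (Imp (And (Neg (Neg r)) (wem (Suc k))) r))"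

definition gen :: "nat \<Rightarrow> (nat \<Rightarrow> form) \<Rightarrow> nat \<Rightarrow> form" where
  "gen k \<epsilon> = (\<lambda>i\<in>{..<2}. if i = 0 then gen_p k (\<epsilon> 0) else gen_q k (\<epsilon> 1))"

lemma gen_0 [simp]: "gen k \<epsilon> 0 = gen_p k (\<epsilon> 0)"
  and gen_1 [simp]: "gen k \<epsilon> (Suc 0) = gen_q k (\<epsilon> 1)"
  by (auto simp: gen_def)

lemma gen_in_substitutions:
  assumes "\<epsilon> \<in> substitutions 2 k"
  shows "gen k \<epsilon> \<in> substitutions 2 (Suc (Suc k))"
proof -
  have "vars (\<epsilon> 0) \<subseteq> {..<k}" "vars (\<epsilon> 1) \<subseteq> {..<k}"
    using assms by (auto simp: substitutions_def PiE_iff Fm_def)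
  then show ?thesis
    using vars_wem[of "Suc k"]
    by (auto simp: substitutions_def gen_def gen_p_def gen_q_def Let_def Fm_def PiE_iff
        subset_iff less_Suc_eq simp del: wem.simps)
qed

text \<open>If all maximal points refute \<open>r\<close>, the pair behaves like
  \<open>\<epsilon>\<close>. If all satisfy \<open>r\<close>, either \<open>wem (Suc k)\<close>
  holds at the root and gives the first formula, or it fails there, which happens only on a fork,
  and the second holds. If the leaves of a fork disagree on \<open>r\<close>, the second formula
  holds at the root.\<close>

lemma gen_unifies:
  assumes "subst \<epsilon> problem \<in> LRF"
  shows "subst (gen k \<epsilon>) problem \<in> LRF"
proof -
  have R: "(forces rhombus V 0 (gen k \<epsilon> 0) \<or> forces rhombus V 0 (gen k \<epsilon> 1)) \<and>
      forces rhombus V 3 (gen k \<epsilon> 0) \<and> forces rhombus V 3 (gen k \<epsilon> 1)"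
    if V: "valuation rhombus V" for V
  proof -
    have h: "forces rhombus V 0 (\<epsilon> 0) \<or> forces rhombus V 0 (\<epsilon> 1)"
      "forces rhombus V 3 (\<epsilon> 0)" "forces rhombus V 3 (\<epsilon> 1)"
      using assms V unfolding subst_problem_in_LRF by blast+
    note m = forces_rhombus_mono[OF V, of "Var (Suc k)"] forces_rhombus_mono[OF V, of "\<epsilon> 1"]
    show ?thesis
      using h m forces_rhombus_wem[OF V, of _ "Suc k"]
      by (auto simp: gen_p_def gen_q_def Let_def forces_rhombus_Imp
          simp del: forces.simps(5) wem.simps)
  qed
  have F: "(forces fork V 0 (gen k \<epsilon> 0) \<or> forces fork V 0 (gen k \<epsilon> 1)) \<and>
      (\<forall>v\<in>{1, 2}. forces fork V v (gen k \<epsilon> 0) \<and> forces fork V v (gen k \<epsilon> 1))"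
    if V: "valuation fork V" for V
  proof -
    have h: "forces fork V 0 (\<epsilon> 0) \<or> forces fork V 0 (\<epsilon> 1)"
      "\<forall>v\<in>{1, 2}. forces fork V v (\<epsilon> 0) \<and> forces fork V v (\<epsilon> 1)"
      using assms V unfolding subst_problem_in_LRF by blast+
    note m = forces_fork_mono[OF V, of "Var (Suc k)"] forces_fork_mono[OF V, of "\<epsilon> 1"]
    show ?thesis
      using h m forces_fork_wem_leaf[of V "Suc k"]
      by (auto simp: gen_p_def gen_q_def Let_def forces_fork_Imp
          simp del: forces.simps(5) wem.simps)
  qed
  show ?thesis unfolding subst_problem_in_LRF using R F by blast
qed

lemma instance_gen:
  assumes "\<epsilon> \<in> substitutions 2 k"
  shows "instance_in LRF 2 \<epsilon> (gen k \<epsilon>)"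
proof -
  \<comment> \<open>Sending \<open>r\<close> to \<open>Bot\<close> makes \<open>Neg r\<close> valid
    and \<open>Neg (Neg r)\<close> absurd. The latter also removes \<open>wem (Suc k)\<close>, so
    the image of the new variable \<open>Var k\<close> is irrelevant.\<close>
  define s where "s = (\<lambda>i. if i < k then Var i else Bot)"
  have e: "subst s (\<epsilon> i) = \<epsilon> i" if "i < 2" for i
    using assms that by (intro subst_Var) (auto simp: s_def substitutions_def PiE_iff Fm_def)
  have s_r: "s (Suc k) = Bot" by (simp add: s_def)
  have p: "subst s (gen_p k (\<epsilon> 0)) =
      Or (And (Neg Bot) (\<epsilon> 0)) (And (Neg (Neg Bot)) (subst s (wem (Suc k))))"
    using e[of 0] s_r by (simp add: gen_p_def Let_def del: wem.simps)
  have q: "subst s (gen_q k (\<epsilon> 1)) =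
      And (Imp (Neg Bot) (\<epsilon> 1)) (Imp (And (Neg (Neg Bot)) (subst s (wem (Suc k)))) Bot)"
    using e[of 1] s_r by (simp add: gen_q_def Let_def del: wem.simps)
  have NN: "forces F V w (Neg Bot)" "\<not> forces F V w (Neg (Neg Bot))"
    if "F \<in> {rhombus, fork}" "w \<in> worlds F" for F V w
    using frame_refl[OF frames_RF[rule_format, OF that(1)] that(2)] that(2) by auto
  have "equiv_in LRF (subst s (gen_p k (\<epsilon> 0))) (\<epsilon> 0)"
    unfolding equiv_in_logic_of[OF frames_RF] p forces.simps(3,4) using NN by blast
  moreover have "equiv_in LRF (subst s (gen_q k (\<epsilon> 1))) (\<epsilon> 1)"
    unfolding equiv_in_logic_of[OF frames_RF] q
  proof (intro ballI allI impI)
    fix F V w assume *: "F \<in> {rhombus, fork}" "valuation F V" "w \<in> worlds F"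
    note F = frames_RF[rule_format, OF *(1)]
    have "forces F V w (Imp (Neg Bot) (\<epsilon> 1)) \<longleftrightarrow> forces F V w (\<epsilon> 1)"
      using NN(1)[OF *(1)] frame_refl[OF F *(3)] *(3) forces_mono[OF F *(2)]
      unfolding forces.simps(5)[of F V w "Neg Bot"] by blast
    moreover have "forces F V w (Imp (And (Neg (Neg Bot)) X) Bot)" for X
      using NN(2)[OF *(1)] unfolding forces.simps(5)[of F V w "And _ _"] forces.simps(3) by blast
    ultimately show "forces F V w (And (Imp (Neg Bot) (\<epsilon> 1))
        (Imp (And (Neg (Neg Bot)) (subst s (wem (Suc k)))) Bot)) \<longleftrightarrow> forces F V w (\<epsilon> 1)"
      unfolding forces.simps(3) by blast
  qed
  ultimately show ?thesis
    unfolding instance_in_def by (intro exI[of _ s]) (auto simp: less_2_cases_iff)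
qed

section \<open>Forks refuting the two formulas, and the pigeonhole argument\<close>

definition leaves :: "nat set \<Rightarrow> nat set \<Rightarrow> nat \<Rightarrow> nat set" where
  "leaves S T = (\<lambda>i. {w. w = 1 \<and> i \<in> S \<or> w = 2 \<and> i \<in> T})"

lemma valuation_leaves: "valuation fork (leaves S T)"
  by (auto simp: valuation_def leaves_def order_fork)

text \<open>A leaf satisfying \<open>r\<close> kills the first disjunct; the second fails because
  \<open>wem (Suc k)\<close> compares the leaves on exactly the variables in
  \<open>{..k}\<close>.\<close>

lemma not_forces_gen_p:
  assumes "Suc k \<in> S" "Suc k \<in> T" "S \<inter> {..k} \<noteq> T \<inter> {..k}"
  shows "\<not> forces fork (leaves S T) 0 (gen_p k B)"
proof -
  have "\<not> forces fork (leaves S T) 0 (wem (Suc k))"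
    unfolding forces_fork_wem_root[OF valuation_leaves] using assms(3)
    by (auto simp: leaves_def less_Suc_eq_le)
  moreover have "\<not> forces fork (leaves S T) 0 (Neg (Var (Suc k)))"
    using assms(1) by (auto simp: forces_fork_Imp leaves_def simp del: forces.simps(5))
  ultimately show ?thesis by (simp add: gen_p_def Let_def del: forces.simps(5) wem.simps)
qed

text \<open>With equal leaves the fork acts as a chain: the root forces \<open>wem (Suc k)\<close>
  and \<open>Neg (Neg r)\<close>, but \<open>leaves\<close> makes no variable true there, so
  \<open>r\<close> fails.\<close>

lemma not_forces_gen_q:
  assumes "Suc k \<in> S"
  shows "\<not> forces fork (leaves S S) 0 (gen_q k C)"
proof -
  have "forces fork (leaves S S) 0 (wem (Suc k))"
    unfolding forces_fork_wem_root[OF valuation_leaves] by (auto simp: leaves_def)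
  moreover have "forces fork (leaves S S) 0 (Neg (Neg (Var (Suc k))))"
    using assms by (auto simp: forces_fork_Imp leaves_def simp del: forces.simps(5))
  moreover have "\<not> forces fork (leaves S S) 0 (Var (Suc k))" by (auto simp: leaves_def)
  ultimately show ?thesis
    using forces_mp[OF is_frame_fork, of 0 "leaves S S"
        "And (Neg (Neg (Var (Suc k)))) (wem (Suc k))" "Var (Suc k)"]
    unfolding gen_q_def Let_def forces.simps(3) worlds_fork by blast
qed

text \<open>Otherwise the two forks would glue to a rhombus refuting \<open>\<epsilon> 0 \<or> \<epsilon> 1\<close>.\<close>

lemma unifier_fork_amalgamation:
  assumes u: "subst \<epsilon> problem \<in> LRF" and \<epsilon>: "\<epsilon> \<in> substitutions 2 k"
    and V: "valuation fork V" and W: "valuation fork W"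
    and eq: "\<And>i. i < k \<Longrightarrow> (1 \<in> V i \<longleftrightarrow> 2 \<in> V i) \<and> (1 \<in> W i \<longleftrightarrow> 2 \<in> W i) \<and> (1 \<in> V i \<longleftrightarrow> 1 \<in> W i)"
  shows "forces fork V 0 (\<epsilon> 0) \<or> forces fork W 0 (\<epsilon> 1)"
proof -
  \<comment> \<open>The middle points copy the roots of the two forks and the top copies their
    common leaf. The cut at \<open>k\<close> keeps \<open>M\<close> persistent, since the leaves of
    \<open>V\<close> and \<open>W\<close> are known to agree only there.\<close>
  define M :: "nat \<Rightarrow> nat set" where
    "M = (\<lambda>i. {w. i < k \<and> (w = 1 \<and> 0 \<in> V i \<or> w = 2 \<and> 0 \<in> W i \<or> w = 3 \<and> 1 \<in> V i)})"
  have mono: "0 \<in> V i \<Longrightarrow> 1 \<in> V i" "0 \<in> W i \<Longrightarrow> 1 \<in> W i" for i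
    using V W unfolding valuation_def order_fork by blast+
  have M: "valuation rhombus M"
    using mono eq by (auto simp: valuation_def M_def order_rhombus)
  have vars: "vars (\<epsilon> 0) \<subseteq> {..<k}" "vars (\<epsilon> 1) \<subseteq> {..<k}"
    using \<epsilon> by (auto simp: substitutions_def PiE_iff Fm_def)
  have "forces rhombus M 0 (\<epsilon> 0) \<or> forces rhombus M 0 (\<epsilon> 1)"
    using u M unfolding subst_problem_in_LRF by blast
  then have "forces rhombus M 1 (\<epsilon> 0) \<or> forces rhombus M 2 (\<epsilon> 1)"
    using forces_rhombus_mono[OF M] by auto
  moreover have "forces rhombus M 1 (\<epsilon> 0) \<longleftrightarrow> forces fork V 0 (\<epsilon> 0)"
    using forces_fork_rhombus[of 1 k M V, OF _ _ vars(1)] eq by (auto simp: M_def)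
  moreover have "forces rhombus M 2 (\<epsilon> 1) \<longleftrightarrow> forces fork W 0 (\<epsilon> 1)"
    using forces_fork_rhombus[of 2 k M W, OF _ _ vars(2)] eq by (auto simp: M_def)
  ultimately show ?thesis by blast
qed

text \<open>A leaf sees only itself, so what it forces depends neither on its partner nor on its
  position. This lets \<open>g\<close> below be a function of a single set.\<close>

lemma forces_fork_leaf:
  "forces fork (leaves S T) (Suc 0) A \<longleftrightarrow> forces fork (leaves S S) (Suc 0) A"
  "forces fork (leaves S T) 2 A \<longleftrightarrow> forces fork (leaves T T) (Suc 0) A"
  by (induction A)
    (auto simp: forces_fork_Imp simp del: forces.simps(5), auto simp: leaves_def)

lemma gen_not_instance:
  assumes u: "subst \<epsilon> problem \<in> LRF" and \<epsilon>: "\<epsilon> \<in> substitutions 2 k"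
  shows "\<not> instance_in LRF 2 (gen k \<epsilon>) \<epsilon>"
proof
  assume "instance_in LRF 2 (gen k \<epsilon>) \<epsilon>"
  then obtain s where s: "\<And>i. i < 2 \<Longrightarrow> equiv_in LRF (subst s (\<epsilon> i)) (gen k \<epsilon> i)"
    by (auto simp: instance_in_def)
  have s_fork: "forces fork (subst_val fork V s) 0 (\<epsilon> i) \<longleftrightarrow> forces fork V 0 (gen k \<epsilon> i)"
    if "valuation fork V" "i < 2" for V i
    using s[OF that(2)] that(1)
    by (simp add: equiv_in_logic_of[OF frames_RF] forces_subst)
  \<comment> \<open>\<open>g S\<close> is the classical valuation of the first \<open>k\<close>
    variables that \<open>s\<close> induces at a leaf of type \<open>S\<close> marked by
    \<open>r\<close>.\<close>
  define g where
    "g S = {i. i < k \<and> forces fork (leaves (insert (Suc k) S) (insert (Suc k) S)) (Suc 0) (s i)}" for S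
  have "inj_on g (Pow {..k})"
  proof (rule inj_onI, rule ccontr)
    fix S T assume ST: "S \<in> Pow {..k}" "T \<in> Pow {..k}" "g S = g T" "S \<noteq> T"
    let ?S = "insert (Suc k) S" and ?T = "insert (Suc k) T"
    \<comment> \<open>If \<open>g S = g T\<close>, all four leaves of these forks agree on the first
      \<open>k\<close> variables after applying \<open>s\<close>, so amalgamation applies; yet the
      first fork refutes \<open>gen_p\<close> and the second \<open>gen_q\<close>.\<close>
    let ?V = "subst_val fork (leaves ?S ?T) s" and ?W = "subst_val fork (leaves ?S ?S) s"
    have eq: "(1 \<in> ?V i \<longleftrightarrow> 2 \<in> ?V i) \<and> (1 \<in> ?W i \<longleftrightarrow> 2 \<in> ?W i) \<and> (1 \<in> ?V i \<longleftrightarrow> 1 \<in> ?W i)"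
      if "i < k" for i
      using \<open>g S = g T\<close> that unfolding g_def mem_subst_val
      by (auto simp: forces_fork_leaf[of ?S ?T] forces_fork_leaf(2)[of ?S ?S])
    have "forces fork ?V 0 (\<epsilon> 0) \<or> forces fork ?W 0 (\<epsilon> 1)"
      using eq
      by (intro unifier_fork_amalgamation[OF u \<epsilon>] valuation_subst_val is_frame_fork valuation_leaves)
    then have "forces fork (leaves ?S ?T) 0 (gen_p k (\<epsilon> 0)) \<or>
        forces fork (leaves ?S ?S) 0 (gen_q k (\<epsilon> 1))"
      using s_fork[OF valuation_leaves, of 0] s_fork[OF valuation_leaves, of 1] by simp
    moreover have "?S \<inter> {..k} \<noteq> ?T \<inter> {..k}" using ST by auto
    ultimately show False using not_forces_gen_p[of k ?S ?T] not_forces_gen_q[of k ?S] by blast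
  qed
  moreover have "g ` Pow {..k} \<subseteq> Pow {..<k}" by (auto simp: g_def)
  \<comment> \<open>The inclusive bound counts: \<open>2^(k+1)\<close> types cannot embed into
    \<open>2^k\<close> valuations.\<close>
  ultimately have "card (Pow {..k}) \<le> card (Pow {..<k})"
    by (intro card_inj_on_le) auto
  then show False by (simp add: card_Pow)
qed

lemma nullary_LRF: "nullary_unification LRF"
proof (rule nullary_if_no_maximal[OF frames_RF])
  show "problem \<in> Fm 2" by (auto simp: problem_def Fm_def)
  have "(\<lambda>i\<in>{..<2}. Neg Bot) \<in> unifiers LRF 2 problem"
    unfolding unifiers_def mem_Collect_eq subst_problem_in_LRF
    by (auto simp: substitutions_def Fm_def intro!: exI[of _ 0])
  then show "unifiers LRF 2 problem \<noteq> {}" by blast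
next
  fix \<epsilon> assume "\<epsilon> \<in> unifiers LRF 2 problem"
  then obtain k where "\<epsilon> \<in> substitutions 2 k" "subst \<epsilon> problem \<in> LRF"
    by (auto simp: unifiers_def)
  then show "\<exists>\<epsilon>'\<in>unifiers LRF 2 problem. instance_in LRF 2 \<epsilon> \<epsilon>' \<and> \<not> instance_in LRF 2 \<epsilon>' \<epsilon>"
    using gen_in_substitutions gen_unifies instance_gen gen_not_instance
    by (intro bexI[of _ "gen k \<epsilon>"]) (auto simp: unifiers_def)
qed

theorem theorem5p8:
  shows "logic_of {rhombus, fork} = logic_of {rhombus} \<inter> logic_of {fork} \<and>
    nullary_unification (logic_of {rhombus, fork})"
  using nullary_LRF by (auto simp: logic_of_def)

end
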